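(* For every integer $n\ge 1$, \[ b(n)\le \frac{25}{44}\Bigl[45^{\log_{10}\left(\frac{n}{5}\right)+1}-1\Bigr], \] and equality holds if and only if $n=5\cdot 10^{k}$ for some integer $k\ge 0$.
   Context: For a positive integer $p$, let $C(p)$ be the product of the decimal digits of $p$ (no leading zeros). For $n\ge 1$, $b(n)=\sum_{i=1}^{n}C(2i-1)$ is the sum of the products of the digits of the first $n$ odd numbers $1,3,\dots,2n-1$. *)

theory Defs
  imports Complex_Main
begin

(* Decimal digits, least significant first; there are no leading zeros, so 0 has the empty list. *)
fun decimal_digits :: "nat \<Rightarrow> nat list" where
  "decimal_digits p = (if p = 0 then [] else p mod 10 # decimal_digits (p div 10))"

declare decimal_digits.simps [simp del]

definition digit_prod :: "nat \<Rightarrow> nat" where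
  "digit_prod p = prod_list (decimal_digits p)"

(* The subtraction is never truncated, since i \<ge> 1. *)
definition odd_digit_prod_sum :: "nat \<Rightarrow> nat" where
  "odd_digit_prod_sum n = (\<Sum>i = 1..n. digit_prod (2 * i - 1))"

end

theory Submission
  imports Defs "HOL-Analysis.Convex"
begin

text \<open>
  Put \<open>\<alpha> = log 10 45\<close>, so that \<open>10 powr \<alpha> = 45\<close>.  Let \<open>T q\<close> be the sum of the digit products of
  all \<open>a < q\<close>, where \<open>0\<close> contributes the empty product \<open>1\<close>.  A leading block \<open>q\<close> followed by one
  further digit behaves multiplicatively, and the odd digits sum to 25 while all digits sum to 45.
  Hence, for \<open>n = 5 * q + s\<close> with \<open>s < 5\<close>, both \<open>odd_digit_prod_sum n\<close> and \<open>T (10 * q + r)\<close> are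
  expressions in \<open>T q\<close> and \<open>digit_prod q\<close>.  In particular \<open>44 / 25 * odd_digit_prod_sum n + 1\<close>
  equals 45 times the value at \<open>x = s / 5\<close> of
  \<open>K(q, x) = (44 * T q + 1 + 44 * digit_prod q * x\<^sup>2) / 45\<close> (the constant \<open>parabola_sum\<close>),
  while the claimed bound says that it is at most \<open>(2 * n) powr \<alpha> = 45 * (q + x) powr \<alpha>\<close>.  So the
  theorem amounts to comparing \<open>K(q, x)\<close> with \<open>(q + x) powr \<alpha>\<close>.

  The parabola in \<open>x\<close> agrees with the digit sums at the points \<open>s / 5\<close>, but the comparison is true
  for every real \<open>x\<close> in \<open>[0, 1]\<close> with \<open>q + x \<ge> 1 / 5\<close>, and in this form it reproduces itself:
  \<open>K(10 q + r, y) \<le> 45 K(q, (r + y) / 10)\<close> for every digit \<open>r\<close> with \<open>10 q + r > 0\<close>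
  (lemma \<open>parabola_sum_step\<close>),
  while the power function satisfies the same relation with equality.  Induction on \<open>q\<close> therefore
  strips off the last digit until \<open>q\<close> is 0 or 1.  For \<open>q = 0\<close> the claim is
  \<open>(44 * x\<^sup>2 + 1) / 45 \<le> x powr \<alpha>\<close>, which follows from concavity of \<open>x powr \<alpha>\<close> as a function of \<open>x\<^sup>2\<close>;
  it fails at \<open>x = 1 / 10\<close>, which is why \<open>q = 1\<close> is treated separately and \<open>q + x\<close> is kept at
  least \<open>1 / 5\<close>.  Equality in the two base cases occurs only at \<open>q + x = 1\<close>, and every step multiplies
  \<open>q + x\<close> by 10, so equality forces \<open>q + x\<close> to be a power of ten.
\<close>

section \<open>Digit products and their sums\<close>

lemma digit_prod_0 [simp]: "digit_prod 0 = 1"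
  by (simp add: digit_prod_def decimal_digits.simps)

lemma digit_prod_rec: "n > 0 \<Longrightarrow> digit_prod n = digit_prod (n div 10) * (n mod 10)"
  by (simp add: digit_prod_def decimal_digits.simps[of n])

lemma digit_prod_append:
  "r < 10 \<Longrightarrow> 10 * q + r > 0 \<Longrightarrow> digit_prod (10 * q + r) = digit_prod q * r"
  by (subst digit_prod_rec) auto

definition digit_prod_sum :: "nat \<Rightarrow> nat" where
  "digit_prod_sum q = (\<Sum>a<q. digit_prod a)"

lemma digit_prod_sum_0 [simp]: "digit_prod_sum 0 = 0"
  and digit_prod_sum_Suc [simp]: "digit_prod_sum (Suc q) = digit_prod_sum q + digit_prod q"
  by (simp_all add: digit_prod_sum_def)

text \<open>
  Appending the digits \<open>0, \<dots>, 9\<close> to a prefix multiplies its digit product by a total of 45.  For the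
  prefix 0 and the digit 0 this rule predicts the product 0, but \<open>digit_prod 0 = 1\<close>; the summand 1
  makes up the difference.
\<close>
lemma digit_prod_sum_append:
  assumes "r < 10" and "10 * q + r > 0"
  shows "real (digit_prod_sum (10 * q + r)) =
    1 + 45 * digit_prod_sum q + digit_prod q * (real r * (real r - 1) / 2)"
proof -
  have "real (digit_prod_sum n) = 1 + 45 * digit_prod_sum (n div 10) +
      digit_prod (n div 10) * (real (n mod 10) * (real (n mod 10) - 1) / 2)" if "n \<ge> 1" for n
    using that
  proof (induction n rule: nat_induct_at_least)
    case base
    then show ?case by simp
  next
    case (Suc n)
    have C: "real (digit_prod n) = digit_prod (n div 10) * real (n mod 10)"
      using digit_prod_rec[of n] Suc.hyps by simp
    show ?case
    proof (cases "n mod 10 = 9")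
      case True
      then have "Suc n div 10 = Suc (n div 10)" "Suc n mod 10 = 0"
        using True by (simp_all add: div_Suc mod_Suc)
      then show ?thesis using Suc.IH C True by (simp add: algebra_simps)
    next
      case False
      then have "Suc n div 10 = n div 10" "Suc n mod 10 = Suc (n mod 10)"
        using False by (simp_all add: div_Suc mod_Suc)
      then show ?thesis using Suc.IH C by (simp add: field_simps)
    qed
  qed
  from this[of "10 * q + r"] show ?thesis using assms by simp
qed

text \<open>
  Write \<open>n = 5 * q + s\<close> with \<open>s < 5\<close>.  The odd numbers below \<open>10 * q\<close> arise by appending an odd digit to each \<open>a < q\<close>, which gives the
  factor \<open>1 + 3 + 5 + 7 + 9 = 25\<close>; the remaining \<open>s\<close> odd numbers append \<open>1, 3, \<dots>, 2 * s - 1\<close> to \<open>q\<close>.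
\<close>
lemma odd_digit_prod_sum_eq:
  "odd_digit_prod_sum n = 25 * digit_prod_sum (n div 5) + (n mod 5)\<^sup>2 * digit_prod (n div 5)"
proof (induction n)
  case 0
  then show ?case by (simp add: odd_digit_prod_sum_def)
next
  case (Suc n)
  have "digit_prod (2 * n + 1) = digit_prod (10 * (n div 5) + (2 * (n mod 5) + 1))"
    by (rule arg_cong[of _ _ digit_prod]) presburger
  also have "\<dots> = digit_prod (n div 5) * (2 * (n mod 5) + 1)"
  proof (rule digit_prod_append)
    show "2 * (n mod 5) + 1 < 10" by presburger
  qed simp
  finally have C: "digit_prod (Suc (2 * n)) = digit_prod (n div 5) * (2 * (n mod 5) + 1)"
    by simp
  have step: "odd_digit_prod_sum (Suc n) = odd_digit_prod_sum n + digit_prod (Suc (2 * n))"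
    by (simp add: odd_digit_prod_sum_def)
  show ?case
  proof (cases "n mod 5 = 4")
    case True
    then have "Suc n div 5 = Suc (n div 5)" "Suc n mod 5 = 0"
      using True by (simp_all add: div_Suc mod_Suc)
    then show ?thesis using Suc.IH C step True by simp
  next
    case False
    then have "Suc n div 5 = n div 5" "Suc n mod 5 = Suc (n mod 5)"
      using False by (simp_all add: div_Suc mod_Suc)
    then show ?thesis using Suc.IH C step by (simp add: algebra_simps power2_eq_square)
  qed
qed

section \<open>The normalised sum and its recursion\<close>

text \<open>
  The quadratic interpolation in \<open>x\<close> is the one dictated by \<open>odd_digit_prod_sum_eq\<close>; the
  normalisation is chosen so that the value at \<open>(1, 0)\<close> and at \<open>(0, 1)\<close> is 1,
  which is what the power function takes at \<open>q + x = 1\<close>.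
\<close>
definition parabola_sum :: "nat \<Rightarrow> real \<Rightarrow> real" where
  "parabola_sum q x = (44 * real (digit_prod_sum q) + 1 + 44 * real (digit_prod q) * x\<^sup>2) / 45"

lemma odd_digit_prod_sum_eq_parabola_sum:
  "44 / 25 * real (odd_digit_prod_sum n) + 1 = 45 * parabola_sum (n div 5) (real (n mod 5) / 5)"
  unfolding odd_digit_prod_sum_eq parabola_sum_def by (simp add: field_simps)

lemma parabola_sum_times_10: "q > 0 \<Longrightarrow> parabola_sum (10 * q) 0 = 45 * parabola_sum q 0"
  using digit_prod_sum_append[of 0 q] by (simp add: parabola_sum_def field_simps)

lemma parabola_sum_power_10: "parabola_sum (10 ^ k) 0 = 45 ^ k"
proof (induction k)
  case 0
  show ?case by (simp add: parabola_sum_def digit_prod_sum_def)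
next
  case (Suc k)
  then show ?case using parabola_sum_times_10[of "10 ^ k"] by simp
qed

text \<open>
  Up to a positive factor, the two sides of \<open>parabola_sum_step\<close> differ by \<open>digit_prod q\<close> times the
  difference of the two sides here.  For \<open>r \<ge> 1\<close> the latter is concave in \<open>y\<close>, with end values
  \<open>r * (10 - r)\<close> and \<open>(9 - r) * (r + 1)\<close>.
\<close>
lemma append_digit_inequality:
  fixes y :: real
  assumes "r < 10" "0 \<le> y" "y \<le> 1"
  shows "10 * (real r * (real r - 1)) + 20 * real r * y\<^sup>2 \<le> 9 * (real r + y)\<^sup>2"
proof (cases "r = 0")
  case False
  define R where "R = real r"
  have R: "1 \<le> R" "R \<le> 9" using assms False by (simp_all add: R_def)
  \<comment> \<open>the chord between the end values, plus a multiple of \<open>y * (1 - y)\<close> due to concavity\<close>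
  have "9 * (R + y)\<^sup>2 - (10 * (R * (R - 1)) + 20 * R * y\<^sup>2) =
      (1 - y) * (R * (10 - R)) + y * ((9 - R) * (R + 1)) + (20 * R - 9) * (y * (1 - y))"
    by (simp add: power2_eq_square algebra_simps)
  also have "\<dots> \<ge> 0" using R assms by (intro add_nonneg_nonneg mult_nonneg_nonneg) auto
  finally show ?thesis by (simp add: R_def)
qed simp

lemma parabola_sum_step:
  assumes "r < 10" "10 * q + r > 0" "0 \<le> y" "y \<le> 1"
  shows "parabola_sum (10 * q + r) y \<le> 45 * parabola_sum q ((real r + y) / 10)"
proof -
  have "real (digit_prod q) * (10 * (real r * (real r - 1)) + 20 * real r * y\<^sup>2)
      \<le> real (digit_prod q) * (9 * (real r + y)\<^sup>2)"
    using append_digit_inequality[of r y] assms by (intro mult_left_mono) auto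
  then show ?thesis
    using digit_prod_sum_append[OF assms(1,2)] digit_prod_append[OF assms(1,2)]
    by (simp add: parabola_sum_def field_simps)
qed

section \<open>Comparison with the power function\<close>

lemma power_powr: "0 \<le> b \<Longrightarrow> (b ^ k) powr c = (b powr c) ^ k" for b c :: real
  by (induction k) (simp_all add: powr_mult)

lemma ten_powr_log_45: "10 powr log 10 45 = (45::real)"
  by simp

lemma log_10_45_bounds: "1 \<le> log 10 (45::real)" "log 10 (45::real) \<le> 2"
proof -
  show "1 \<le> log 10 (45::real)" by (simp add: le_log_iff)
  show "log 10 (45::real) \<le> 2" by (simp add: log_le_iff)
qed

text \<open>The true value is about 14.3; the bound rests on \<open>5 ^ 10 \<le> 10 ^ 7\<close> and \<open>45 ^ 7 < 15 ^ 10\<close>.\<close>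
lemma five_powr_log_45: "5 powr log 10 45 < (15::real)"
proof (rule ccontr)
  let ?a = "log 10 (45::real)"
  assume "\<not> 5 powr ?a < (15::real)"
  then have "15 ^ 10 \<le> ((5::real) powr ?a) ^ 10" by (intro power_mono) auto
  also have "\<dots> = (5 ^ 10) powr ?a" by (rule power_powr[symmetric]) simp
  also have "\<dots> \<le> (10 ^ 7) powr ?a" using log_10_45_bounds by (intro powr_mono2) auto
  also have "\<dots> = (10 powr ?a) ^ 7" by (rule power_powr) simp
  also have "\<dots> = 45 ^ 7" by (simp only: ten_powr_log_45)
  finally show False by simp
qed

text \<open>
  As a function of \<open>v = x powr \<alpha>\<close>, the square \<open>x\<^sup>2 = v powr (2 / \<alpha>)\<close> is convex, so it lies below its
  chord between \<open>x = 1 / 5\<close> and \<open>x = 1\<close>.  At \<open>x = 1\<close> the claim is an equality, and at \<open>x = 1 / 5\<close> it is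
  strict because \<open>(1 / 5) powr \<alpha> > 1 / 15\<close>.
\<close>
lemma quadratic_below_powr:
  fixes x :: real
  assumes "1 / 5 \<le> x" "x < 1"
  shows "(1 + 44 * x\<^sup>2) / 45 < x powr log 10 45"
proof -
  define a where "a = log 10 (45::real)"
  have a: "1 \<le> a" "a \<le> 2" using log_10_45_bounds by (simp_all add: a_def)
  define v where "v = x powr a"
  define v0 where "v0 = (1 / 5 :: real) powr a"
  have v0: "v0 > 1 / 15"
    using five_powr_log_45 by (simp add: v0_def a_def powr_divide field_simps)
  have "v0 \<le> v" using a assms by (auto simp: v_def v0_def intro: powr_mono2)
  have "v < 1" using a assms powr_less_mono2[of a x 1] by (simp add: v_def)
  define m where "m = (1 - v) / (1 - v0)"
  have m: "0 < m" "m \<le> 1" using \<open>v0 \<le> v\<close> \<open>v < 1\<close> by (simp_all add: m_def)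
  have "m * (1 - v0) = 1 - v" using \<open>v0 \<le> v\<close> \<open>v < 1\<close> by (simp add: m_def)
  then have v: "v = (1 - m) * 1 + m * v0" by (simp add: algebra_simps)
  have "convex_on {0<..} (\<lambda>z::real. z powr (2 / a))"
    using a by (intro powr_convex) (simp add: field_simps)
  then have "((1 - m) * 1 + m * v0) powr (2 / a) \<le> (1 - m) * 1 powr (2 / a) + m * v0 powr (2 / a)"
    using convex_onD[of "{0<..}" "\<lambda>z::real. z powr (2 / a)" m 1 v0] m v0 by simp
  then have "v powr (2 / a) \<le> (1 - m) + m * v0 powr (2 / a)" using v by simp
  moreover have "v powr (2 / a) = x\<^sup>2" "v0 powr (2 / a) = 1 / 25"
    using a assms by (simp_all add: v_def v0_def powr_powr power2_eq_square)
  ultimately have "x\<^sup>2 \<le> (1 - m) + m / 25" by simp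
  moreover have "m / 15 < m * v0" using mult_strict_left_mono[OF v0 m(1)] by simp
  moreover have "v = 1 - m + m * v0" using v by simp
  ultimately have "(1 + 44 * x\<^sup>2) / 45 < v" using m(1) by argo
  then show ?thesis by (simp add: v_def a_def)
qed

text \<open>
  The range of \<open>x\<close> is a real interval because removing the last digit \<open>r\<close> replaces \<open>x\<close> by
  \<open>(r + x) / 10\<close>, which is no longer of the form \<open>s / 5\<close>.  It divides \<open>q + x\<close> by 10, so the lower bound
  \<open>1 / 5\<close> survives exactly when \<open>q + x \<ge> 2\<close>.
\<close>
theorem parabola_sum_le_powr:
  fixes x :: real
  assumes "0 \<le> x" "x \<le> 1" "1 / 5 \<le> q + x"
  shows "parabola_sum q x \<le> (q + x) powr log 10 45 \<and>
    (parabola_sum q x = (q + x) powr log 10 45 \<longrightarrow> (\<exists>k::nat. q + x = 10 ^ k))"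
  using assms
proof (induction q arbitrary: x rule: less_induct)
  case (less q)
  consider "q = 0" | "q = 1" | "q \<ge> 2" by linarith
  then show ?case
  proof cases
    case 1
    show ?thesis
    proof (cases "x = 1")
      case True
      then show ?thesis using 1 by (auto simp: parabola_sum_def intro: exI[of _ 0])
    next
      case False
      then show ?thesis
        using quadratic_below_powr[of x] less.prems 1 by (auto simp: parabola_sum_def)
    qed
  next
    case 2
    have K: "parabola_sum 1 x = 1 + 44 / 45 * x\<^sup>2"
      using digit_prod_append[of 1 0] by (simp add: parabola_sum_def field_simps)
    have "x\<^sup>2 \<le> x" using less.prems by (simp add: power2_eq_square mult_left_le)
    moreover have "1 + x \<le> (1 + x) powr log 10 45"
      using powr_mono[of 1 "log 10 45" "1 + x"] log_10_45_bounds less.prems by simp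
    ultimately show ?thesis
      using K 2 less.prems by (cases "x = 0") (auto intro: exI[of _ 0])
  next
    case 3
    define p r where "p = q div 10" and "r = q mod 10"
    define z where "z = (real r + x) / 10"
    have q: "q = 10 * p + r" and "r < 10" by (simp_all add: p_def r_def)
    have scale: "real q + x = 10 * (real p + z)" by (simp add: q z_def)
    have "real r \<le> 9" using \<open>r < 10\<close> by simp
    have "0 \<le> z" using less.prems by (simp add: z_def)
    moreover have "z \<le> 1" using less.prems \<open>real r \<le> 9\<close> by (simp add: z_def)
    moreover have "1 / 5 \<le> real p + z"
    proof -
      have "2 \<le> real q" using 3 by simp
      then show ?thesis using scale less.prems(1) by argo
    qed
    moreover have "p < q" using 3 by (simp add: p_def)
    ultimately have IH: "parabola_sum p z \<le> (p + z) powr log 10 45"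
      "parabola_sum p z = (p + z) powr log 10 45 \<Longrightarrow> \<exists>k::nat. p + z = 10 ^ k"
      using less.IH[of p z] by auto
    have step: "parabola_sum q x \<le> 45 * parabola_sum p z"
      unfolding q z_def using 3 q \<open>r < 10\<close> less.prems by (intro parabola_sum_step) auto
    have power: "(q + x) powr log 10 45 = 45 * (p + z) powr log 10 45"
      unfolding scale using \<open>0 \<le> z\<close> by (simp add: powr_mult del: distrib_left_numeral)
    have "\<exists>k::nat. q + x = 10 ^ k" if "parabola_sum q x = (q + x) powr log 10 45"
    proof -
      have "parabola_sum p z = (p + z) powr log 10 45"
        using that step power IH(1) by linarith
      then obtain k :: nat where "p + z = 10 ^ k" using IH(2) by blast
      then have "q + x = 10 ^ Suc k" using scale by simp
      then show ?thesis by blast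
    qed
    moreover have "parabola_sum q x \<le> (q + x) powr log 10 45"
      using step power IH(1) by linarith
    ultimately show ?thesis by blast
  qed
qed

section \<open>The bound for odd numbers\<close>

lemma bound_base_change:
  assumes "n \<ge> 1"
  shows "(45::real) powr (log 10 (real n / 5) + 1) = 45 * (real n / 5) powr log 10 45"
proof -
  have "(45::real) powr log 10 (real n / 5) = (real n / 5) powr log 10 45"
    using assms by (simp add: powr_def log_def)
  then show ?thesis by (simp add: powr_add)
qed

theorem theorem5:
  fixes n :: nat
  assumes "n \<ge> 1"
  shows "real (odd_digit_prod_sum n) \<le> 25 / 44 * (45 powr (log 10 (real n / 5) + 1) - 1) \<and>
    (real (odd_digit_prod_sum n) = 25 / 44 * (45 powr (log 10 (real n / 5) + 1) - 1) \<longleftrightarrow>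
      (\<exists>k::nat. n = 5 * 10 ^ k))"
proof -
  define q x where "q = n div 5" and "x = real (n mod 5) / 5"
  have n: "real n / 5 = real q + x"
  proof -
    have "real n = real (5 * q + n mod 5)" by (simp add: q_def)
    then show ?thesis by (simp add: x_def)
  qed
  have "n mod 5 \<le> 4" by presburger
  then have x: "0 \<le> x" "x \<le> 1" by (simp_all add: x_def)
  have "1 / 5 \<le> real q + x" using n assms by simp
  note K = parabola_sum_le_powr[OF x this]
  note b = odd_digit_prod_sum_eq_parabola_sum[of n, folded q_def x_def]
  note bound = bound_base_change[OF assms, unfolded n]
  have le: "real (odd_digit_prod_sum n) \<le> 25 / 44 * (45 powr (log 10 (q + x) + 1) - 1)"
    unfolding bound using K b by (auto simp: field_simps)
  have eq: "real (odd_digit_prod_sum n) = 25 / 44 * (45 powr (log 10 (q + x) + 1) - 1) \<longleftrightarrow>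
      parabola_sum q x = (q + x) powr log 10 45"
    unfolding bound using b by (auto simp: field_simps)
  have "parabola_sum q x = (q + x) powr log 10 45 \<longleftrightarrow> (\<exists>k::nat. n = 5 * 10 ^ k)"
  proof
    assume "parabola_sum q x = (q + x) powr log 10 45"
    then obtain k :: nat where "real n / 5 = 10 ^ k" using K n by auto
    then have "real n = real (5 * 10 ^ k)" by simp
    then show "\<exists>k::nat. n = 5 * 10 ^ k" by (metis of_nat_eq_iff)
  next
    assume "\<exists>k::nat. n = 5 * 10 ^ k"
    then obtain k :: nat where "n = 5 * 10 ^ k" by blast
    then have "q = 10 ^ k" "x = 0" by (simp_all add: q_def x_def)
    moreover have "(10 ^ k :: real) powr log 10 45 = 45 ^ k"
      using power_powr[of 10 k "log 10 45"] by (simp only: ten_powr_log_45)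
    ultimately show "parabola_sum q x = (q + x) powr log 10 45"
      by (simp add: parabola_sum_power_10)
  qed
  with le eq show ?thesis unfolding n by blast
qed

end
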